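(* Every f.LG-derivation of an f.LG-sequent $S$ can be translated into an fD.LG-derivation of the fD.LG-sequent $\lceil S\rceil$.
   Context: **The focused calculus f.LG** (minimal focused Lambek-Grishin calculus of Moortgat and Moot, with axioms on atoms only). Formulas are built from positive atoms $p$ and negative atoms $n$ by the binary connectives $\otimes,\oslash,\ominus,\oplus,\backslash,/$. A formula is positive if it is a positive atom or has main connective $\otimes,\oslash,\ominus$, and negative otherwise. Input structures $X ::= A\mid X\hat\otimes X\mid X\hat\oslash\Delta\mid\Delta\hat\ominus X$; output structures $\Delta ::= A\mid\Delta\check\oplus\Delta\mid X\check\backslash\Delta\mid\Delta\check/X$ ($A$ any formula). Sequents: neutral $X\vdash\Delta$, right-focused $X\vdash[A]$, left-focused $[A]\vdash\Delta$. Rules: axioms $p\vdash[p]$ and $[n]\vdash n$; focusing/defocusing: $X\vdash[A]\Rightarrow X\vdash A$ and $A\vdash\Delta\Rightarrow[A]\vdash\Delta$ for $A$ positive, $[A]\vdash\Delta\Rightarrow A\vdash\Delta$ and $X\vdash A\Rightarrow X\vdash[A]$ for $A$ negative; neutral display postulates $Y\vdash X\check\backslash\Delta\Leftrightarrow X\hat\otimes Y\vdash\Delta\Leftrightarrow X\vdash\Delta\check/Y$ and $X\hat\oslash\Delta\vdash\Gamma\Leftrightarrow X\vdash\Gamma\check\oplus\Delta\Leftrightarrow\Gamma\hat\ominus X\vdash\Delta$; translation rules replacing (in neutral sequents) $A\hat\star B$ by $A\star B$ on the left for $\star\in\{\otimes,\oslash,\ominus\}$ and $A\check\star B$ by $A\star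 B$ on the right for $\star\in\{\oplus,\backslash,/\}$ ($A,B$ formulas, standing alone on that side); tonicity rules: $X\vdash[A],Y\vdash[B]\Rightarrow X\hat\otimes Y\vdash[A\otimes B]$; $[A]\vdash\Gamma,[B]\vdash\Delta\Rightarrow[A\oplus B]\vdash\Gamma\check\oplus\Delta$; from $X\vdash[A]$ and $[B]\vdash\Delta$ infer each of $X\hat\oslash\Delta\vdash[A\oslash B]$, $\Delta\hat\ominus X\vdash[B\ominus A]$, $[A\backslash B]\vdash X\check\backslash\Delta$, $[B/A]\vdash\Delta\check/X$. **Translation $\lceil\cdot\rceil$.** For an f.LG-formula define a positive fD.LG-formula $A^+$ and a negative one $A^-$ by: $p^+=p$, $(A\otimes B)^+=A^+\otimes B^+$, $(A\oslash B)^+=A^+\oslash B^-$, $(A\ominus B)^+=A^-\ominus B^+$, $n^-=n$, $(A\oplus B)^-=A^-\oplus B^-$, $(A\backslash B)^-=A^+\backslash B^-$, $(A/B)^-=A^-/B^+$; $A^-=\ \uparrow(A^+)$ if $A$ is positive and $A^+=\ \downarrow(A^-)$ if $A$ is negative. An input structure $X$ is sent to the positive structure $X^+$ (replace each formula $A$ in input position by $A^+$ and each formula in output position by $A^-$, keeping structural connectives), an output structure $\Delta$ to the negative structure $\Delta^-$ likewise. Then $\lceil X\vdash[A]\rceil=X^+\vdash_+A^+$, $\lceil[A]\vdash\Delta\rceil=A^-\vdash_-\Delta^-$, $\lceil X\vdash\Delta\rceil=X^+\vdash_0\Delta^-$. **The calculus fD.LG.** Over the same disjoint countably infinite sets of positive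 atoms $p$ and negative atoms $n$. Formulas of four sorts: pure positive $P ::= p\mid \mathring P\otimes\mathring P\mid \mathring P\oslash\mathring N\mid \mathring N\ominus\mathring P$; pure negative $N ::= n\mid \mathring N\oplus\mathring N\mid \mathring P\backslash\mathring N\mid \mathring N/\mathring P$; shifted positive $\dot P ::= \,\downarrow N$; shifted negative $\dot N ::= \,\uparrow P$. A ring means "pure or shifted": $\mathring P$ (general positive) is $P$ or $\dot P$, $\mathring N$ (general negative) is $N$ or $\dot N$; same convention for structures and for $Q,M,\dots$ Structures (structural connectives carry $\hat{\ }$ or $\check{\ }$): pure positive $X ::= P\mid \check{\Downarrow}\dot\Delta\mid \mathring X\hat\otimes\mathring X\mid\mathring X\hat\oslash\mathring\Delta\mid\mathring\Delta\hat\ominus\mathring X$; pure negative $\Delta ::= N\mid\hat{\Uparrow}\dot X\mid\mathring\Delta\check\oplus\mathring\Delta\mid\mathring X\check\backslash\mathring\Delta\mid\mathring\Delta\check/\mathring X$; shifted positive $\dot X ::= \dot P\mid\check\downarrow\Delta\mid\mathring X\check\oplus_\ell\mathring\Delta\mid\mathring\Delta\check\oplus_r\mathring X\mid\mathring\Delta\check\backslash_\ell\mathring\Delta\mid\mathring X\check\backslash_r\mathring X\mid\mathring X\check/_\ell\mathring X\mid\mathring\Delta\check/_r\mathring\Delta$; shifted negative $\dot\Delta ::= \dot N\mid\hat\uparrow X\mid\mathring\Delta\hat\otimes_\ell\mathring X\mid\mathring X\hat\otimes_r\mathring\Delta\mid\mathring\Delta\hat\oslash_\ell\mathring\Delta\mid\mathring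 X\hat\oslash_r\mathring X\mid\mathring X\hat\ominus_\ell\mathring X\mid\mathring\Delta\hat\ominus_r\mathring\Delta$. Sequents: positive $\mathring X\vdash_+\mathring Y$, negative $\mathring\Gamma\vdash_-\mathring\Delta$, neutral $\mathring X\vdash_0\mathring\Delta$ (the exact turnstile is determined by the sorts of both sides). Rules ($\Rightarrow$: premises to conclusion; $\Leftrightarrow$: both directions). *Axioms:* $p\vdash_+p$; $n\vdash_-n$. *Cuts:* $\mathring X\vdash_+\mathring P,\ \mathring P\vdash_+\mathring Y\Rightarrow\mathring X\vdash_+\mathring Y$; $\mathring\Gamma\vdash_-\mathring N,\ \mathring N\vdash_-\mathring\Delta\Rightarrow\mathring\Gamma\vdash_-\mathring\Delta$; $\mathring X\vdash_+\mathring P,\ \mathring P\vdash_0\mathring\Delta\Rightarrow\mathring X\vdash_0\mathring\Delta$; $\mathring X\vdash_0\mathring N,\ \mathring N\vdash_-\mathring\Delta\Rightarrow\mathring X\vdash_0\mathring\Delta$. *Translation rules:* $\mathring P\hat\otimes\mathring Q\vdash_0\mathring\Delta\Rightarrow\mathring P\otimes\mathring Q\vdash_0\mathring\Delta$; $\mathring P\hat\oslash\mathring N\vdash_0\mathring\Delta\Rightarrow\mathring P\oslash\mathring N\vdash_0\mathring\Delta$; $\mathring N\hat\ominus\mathring P\vdash_0\mathring\Delta\Rightarrow\mathring N\ominus\mathring P\vdash_0\mathring\Delta$; $\mathring X\vdash_0\mathring N\check\oplus\mathring M\Rightarrow\mathring X\vdash_0\mathring N\oplus\mathring M$; $\mathring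 X\vdash_0\mathring P\check\backslash\mathring N\Rightarrow\mathring X\vdash_0\mathring P\backslash\mathring N$; $\mathring X\vdash_0\mathring N\check/\mathring P\Rightarrow\mathring X\vdash_0\mathring N/\mathring P$; $\mathring X\vdash_+\check\downarrow N\Rightarrow\mathring X\vdash_+\downarrow N$; $\hat\uparrow P\vdash_-\mathring\Delta\Rightarrow\ \uparrow P\vdash_-\mathring\Delta$. *Tonicity rules:* $\mathring X\vdash_+\mathring P,\ \mathring Y\vdash_+\mathring Q\Rightarrow\mathring X\hat\otimes\mathring Y\vdash_+\mathring P\otimes\mathring Q$; $\mathring N\vdash_-\mathring\Gamma,\ \mathring M\vdash_-\mathring\Delta\Rightarrow\mathring N\oplus\mathring M\vdash_-\mathring\Gamma\check\oplus\mathring\Delta$; from $\mathring X\vdash_+\mathring P$ and $\mathring N\vdash_-\mathring\Delta$ infer each of $\mathring X\hat\oslash\mathring\Delta\vdash_+\mathring P\oslash\mathring N$, $\ \mathring\Delta\hat\ominus\mathring X\vdash_+\mathring N\ominus\mathring P$, $\ \mathring P\backslash\mathring N\vdash_-\mathring X\check\backslash\mathring\Delta$, $\ \mathring N/\mathring P\vdash_-\mathring\Delta\check/\mathring X$; $N\vdash_-\Delta\Rightarrow\ \downarrow N\vdash_+\check\downarrow\Delta$; $X\vdash_+P\Rightarrow\hat\uparrow X\vdash_-\uparrow P$. *Display postulates:* $\mathring Y\vdash_0\mathring X\check\backslash\mathring\Delta\Leftrightarrow\mathring X\hat\otimes\mathring Y\vdash_0\mathring\Delta\Leftrightarrow\mathring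 X\vdash_0\mathring\Delta\check/\mathring Y$; $\mathring X\hat\oslash\mathring\Delta\vdash_0\mathring\Gamma\Leftrightarrow\mathring X\vdash_0\mathring\Gamma\check\oplus\mathring\Delta\Leftrightarrow\mathring\Gamma\hat\ominus\mathring X\vdash_0\mathring\Delta$; $\mathring Y\vdash_+\mathring X\check\backslash_r\mathring Z\Leftrightarrow\mathring X\hat\otimes\mathring Y\vdash_+\mathring Z\Leftrightarrow\mathring X\vdash_+\mathring Z\check/_\ell\mathring Y$; $\mathring\Sigma\hat\oslash_\ell\mathring\Delta\vdash_-\mathring\Gamma\Leftrightarrow\mathring\Sigma\vdash_-\mathring\Gamma\check\oplus\mathring\Delta\Leftrightarrow\mathring\Gamma\hat\ominus_r\mathring\Sigma\vdash_-\mathring\Delta$; $\mathring\Gamma\hat\ominus\mathring X\vdash_+\mathring Y\Leftrightarrow\mathring X\vdash_+\mathring\Gamma\check\oplus_r\mathring Y\Leftrightarrow\mathring X\hat\oslash_r\mathring Y\vdash_-\mathring\Gamma$; $\mathring X\hat\oslash\mathring\Delta\vdash_+\mathring Y\Leftrightarrow\mathring X\vdash_+\mathring Y\check\oplus_\ell\mathring\Delta\Leftrightarrow\mathring Y\hat\ominus_\ell\mathring X\vdash_-\mathring\Delta$; $\mathring\Gamma\vdash_-\mathring X\check\backslash\mathring\Delta\Leftrightarrow\mathring X\hat\otimes_r\mathring\Gamma\vdash_-\mathring\Delta\Leftrightarrow\mathring X\vdash_+\mathring\Delta\check/_r\mathring\Gamma$; $\mathring Y\vdash_+\mathring\Gamma\check\backslash_\ell\mathring\Delta\Leftrightarrow\mathring\Gamma\hat\otimes_\ell\mathring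 Y\vdash_-\mathring\Delta\Leftrightarrow\mathring\Gamma\vdash_-\mathring\Delta\check/\mathring Y$; $\hat\uparrow X\vdash_-\dot\Delta\Leftrightarrow X\vdash_+\check\Downarrow\dot\Delta$; $\hat\uparrow X\vdash_-\Delta\Leftrightarrow X\vdash_+\check\downarrow\Delta$; $\dot X\vdash_+\check\downarrow\Delta\Leftrightarrow\hat\Uparrow\dot X\vdash_-\Delta$. *Structural rules:* $\mathring X\vdash_0\Delta\Leftrightarrow\mathring X\vdash_+\check\downarrow\Delta$; $X\vdash_0\mathring\Delta\Leftrightarrow\hat\uparrow X\vdash_-\mathring\Delta$. *)

theory Defs
  imports Main
begin

text \<open>
  Throughout, connectives are named after their \LaTeX{} symbols: \<open>Otimes\<close>, \<open>Oslash\<close>, \<open>Ominus\<close>,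
  \<open>Oplus\<close>, \<open>Bslash\<close> (left residual), \<open>Slash\<close> (right residual), with arguments in written order.
\<close>

datatype patom = PosAtom nat
datatype natom = NegAtom nat


section \<open>The focused calculus f.LG\<close>

datatype ffm =
    fPAt patom
  | fNAt natom
  | fOtimes ffm ffm
  | fOslash ffm ffm
  | fOminus ffm ffm
  | fOplus ffm ffm
  | fBslash ffm ffm
  | fSlash ffm ffm

fun positive :: "ffm \<Rightarrow> bool" where
  "positive (fPAt p) = True"
| "positive (fOtimes A B) = True"
| "positive (fOslash A B) = True"
| "positive (fOminus A B) = True"
| "positive _ = False"

definition negative :: "ffm \<Rightarrow> bool" where
  "negative A \<longleftrightarrow> \<not> positive A"

datatype fin =
    fIn ffm
  | fOtimesS fin fin
  | fOslashS fin fout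
  | fOminusS fout fin
and fout =
    fOut ffm
  | fOplusS fout fout
  | fBslashS fin fout
  | fSlashS fout fin

datatype fseq =
    Neutral fin fout
  | RFocus fin ffm
  | LFocus ffm fout

inductive fLG :: "fseq \<Rightarrow> bool" where
  f_axP: "fLG (RFocus (fIn (fPAt p)) (fPAt p))"
| f_axN: "fLG (LFocus (fNAt n) (fOut (fNAt n)))"
(* focusing and defocusing *)
| f_foc_pos: "positive A \<Longrightarrow> fLG (RFocus X A) \<Longrightarrow> fLG (Neutral X (fOut A))"
| f_defoc_pos: "positive A \<Longrightarrow> fLG (Neutral (fIn A) D) \<Longrightarrow> fLG (LFocus A D)"
| f_foc_neg: "negative A \<Longrightarrow> fLG (LFocus A D) \<Longrightarrow> fLG (Neutral (fIn A) D)"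
| f_defoc_neg: "negative A \<Longrightarrow> fLG (Neutral X (fOut A)) \<Longrightarrow> fLG (RFocus X A)"
(* display postulates *)
| f_dp_bslash_otimes: "fLG (Neutral Y (fBslashS X D)) \<Longrightarrow> fLG (Neutral (fOtimesS X Y) D)"
| f_dp_otimes_bslash: "fLG (Neutral (fOtimesS X Y) D) \<Longrightarrow> fLG (Neutral Y (fBslashS X D))"
| f_dp_otimes_slash: "fLG (Neutral (fOtimesS X Y) D) \<Longrightarrow> fLG (Neutral X (fSlashS D Y))"
| f_dp_slash_otimes: "fLG (Neutral X (fSlashS D Y)) \<Longrightarrow> fLG (Neutral (fOtimesS X Y) D)"
| f_dp_oslash_oplus: "fLG (Neutral (fOslashS X D) G) \<Longrightarrow> fLG (Neutral X (fOplusS G D))"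
| f_dp_oplus_oslash: "fLG (Neutral X (fOplusS G D)) \<Longrightarrow> fLG (Neutral (fOslashS X D) G)"
| f_dp_oplus_ominus: "fLG (Neutral X (fOplusS G D)) \<Longrightarrow> fLG (Neutral (fOminusS G X) D)"
| f_dp_ominus_oplus: "fLG (Neutral (fOminusS G X) D) \<Longrightarrow> fLG (Neutral X (fOplusS G D))"
(* translation rules *)
| f_tr_otimes: "fLG (Neutral (fOtimesS (fIn A) (fIn B)) D) \<Longrightarrow> fLG (Neutral (fIn (fOtimes A B)) D)"
| f_tr_oslash: "fLG (Neutral (fOslashS (fIn A) (fOut B)) D) \<Longrightarrow> fLG (Neutral (fIn (fOslash A B)) D)"
| f_tr_ominus: "fLG (Neutral (fOminusS (fOut A) (fIn B)) D) \<Longrightarrow> fLG (Neutral (fIn (fOminus A B)) D)"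
| f_tr_oplus: "fLG (Neutral X (fOplusS (fOut A) (fOut B))) \<Longrightarrow> fLG (Neutral X (fOut (fOplus A B)))"
| f_tr_bslash: "fLG (Neutral X (fBslashS (fIn A) (fOut B))) \<Longrightarrow> fLG (Neutral X (fOut (fBslash A B)))"
| f_tr_slash: "fLG (Neutral X (fSlashS (fOut A) (fIn B))) \<Longrightarrow> fLG (Neutral X (fOut (fSlash A B)))"
(* tonicity rules *)
| f_ton_otimes: "fLG (RFocus X A) \<Longrightarrow> fLG (RFocus Y B) \<Longrightarrow> fLG (RFocus (fOtimesS X Y) (fOtimes A B))"
| f_ton_oplus: "fLG (LFocus A G) \<Longrightarrow> fLG (LFocus B D) \<Longrightarrow> fLG (LFocus (fOplus A B) (fOplusS G D))"
| f_ton_oslash: "fLG (RFocus X A) \<Longrightarrow> fLG (LFocus B D) \<Longrightarrow> fLG (RFocus (fOslashS X D) (fOslash A B))"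
| f_ton_ominus: "fLG (RFocus X A) \<Longrightarrow> fLG (LFocus B D) \<Longrightarrow> fLG (RFocus (fOminusS D X) (fOminus B A))"
| f_ton_bslash: "fLG (RFocus X A) \<Longrightarrow> fLG (LFocus B D) \<Longrightarrow> fLG (LFocus (fBslash A B) (fBslashS X D))"
| f_ton_slash: "fLG (RFocus X A) \<Longrightarrow> fLG (LFocus B D) \<Longrightarrow> fLG (LFocus (fSlash B A) (fSlashS D X))"


section \<open>The calculus fD.LG\<close>

text \<open>
  One type per sort: \<open>p\<close>/\<open>n\<close> pure positive/negative, \<open>sp\<close>/\<open>sn\<close> shifted positive/negative, and
  \<open>gp\<close>/\<open>gn\<close> the ringed (pure or shifted) sorts.
\<close>

datatype pfm =
    PAt patom
  | Otimes gpfm gpfm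
  | Oslash gpfm gnfm
  | Ominus gnfm gpfm
and nfm =
    NAt natom
  | Oplus gnfm gnfm
  | Bslash gpfm gnfm
  | Slash gnfm gpfm
and spfm = Down nfm
and snfm = Up pfm
and gpfm = PureP pfm | ShiftP spfm
and gnfm = PureN nfm | ShiftN snfm

text \<open>
  Suffix \<open>S\<close> marks the structural counterpart of a connective, suffixes \<open>L\<close>, \<open>R\<close> the variants with
  index \<open>\<ell>\<close>, \<open>r\<close>; \<open>DDownS\<close> and \<open>UUpS\<close> are the double arrows.
\<close>

datatype pst =
    PFm pfm
  | DDownS snst
  | OtimesS gpst gpst
  | OslashS gpst gnst
  | OminusS gnst gpst
and nst =
    NFm nfm
  | UUpS spst
  | OplusS gnst gnst
  | BslashS gpst gnst
  | SlashS gnst gpst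
and spst =
    SPFm spfm
  | DownS nst
  | OplusL gpst gnst
  | OplusR gnst gpst
  | BslashL gnst gnst
  | BslashR gpst gpst
  | SlashL gpst gpst
  | SlashR gnst gnst
and snst =
    SNFm snfm
  | UpS pst
  | OtimesL gnst gpst
  | OtimesR gpst gnst
  | OslashL gnst gnst
  | OslashR gpst gpst
  | OminusL gpst gpst
  | OminusR gnst gnst
and gpst = PureX pst | ShiftX spst
and gnst = PureD nst | ShiftD snst

fun pemb :: "gpfm \<Rightarrow> gpst" where
  "pemb (PureP P) = PureX (PFm P)"
| "pemb (ShiftP P) = ShiftX (SPFm P)"

fun nemb :: "gnfm \<Rightarrow> gnst" where
  "nemb (PureN N) = PureD (NFm N)"
| "nemb (ShiftN N) = ShiftD (SNFm N)"

datatype dseq =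
    PosSeq gpst gpst  (infix "\<turnstile>\<^sub>+" 50)
  | NegSeq gnst gnst  (infix "\<turnstile>\<^sub>-" 50)
  | NeutSeq gpst gnst (infix "\<turnstile>\<^sub>0" 50)

inductive fDLG :: "dseq \<Rightarrow> bool" where
  axP: "fDLG (PureX (PFm (PAt p)) \<turnstile>\<^sub>+ PureX (PFm (PAt p)))"
| axN: "fDLG (PureD (NFm (NAt n)) \<turnstile>\<^sub>- PureD (NFm (NAt n)))"
(* cuts *)
| cut_pos: "fDLG (X \<turnstile>\<^sub>+ pemb P) \<Longrightarrow> fDLG (pemb P \<turnstile>\<^sub>+ Y) \<Longrightarrow> fDLG (X \<turnstile>\<^sub>+ Y)"
| cut_neg: "fDLG (G \<turnstile>\<^sub>- nemb N) \<Longrightarrow> fDLG (nemb N \<turnstile>\<^sub>- D) \<Longrightarrow> fDLG (G \<turnstile>\<^sub>- D)"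
| cut_pos_neut: "fDLG (X \<turnstile>\<^sub>+ pemb P) \<Longrightarrow> fDLG (pemb P \<turnstile>\<^sub>0 D) \<Longrightarrow> fDLG (X \<turnstile>\<^sub>0 D)"
| cut_neut_neg: "fDLG (X \<turnstile>\<^sub>0 nemb N) \<Longrightarrow> fDLG (nemb N \<turnstile>\<^sub>- D) \<Longrightarrow> fDLG (X \<turnstile>\<^sub>0 D)"
(* translation rules *)
| tr_otimes: "fDLG (PureX (OtimesS (pemb P) (pemb Q)) \<turnstile>\<^sub>0 D) \<Longrightarrow> fDLG (PureX (PFm (Otimes P Q)) \<turnstile>\<^sub>0 D)"
| tr_oslash: "fDLG (PureX (OslashS (pemb P) (nemb N)) \<turnstile>\<^sub>0 D) \<Longrightarrow> fDLG (PureX (PFm (Oslash P N)) \<turnstile>\<^sub>0 D)"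
| tr_ominus: "fDLG (PureX (OminusS (nemb N) (pemb P)) \<turnstile>\<^sub>0 D) \<Longrightarrow> fDLG (PureX (PFm (Ominus N P)) \<turnstile>\<^sub>0 D)"
| tr_oplus: "fDLG (X \<turnstile>\<^sub>0 PureD (OplusS (nemb N) (nemb M))) \<Longrightarrow> fDLG (X \<turnstile>\<^sub>0 PureD (NFm (Oplus N M)))"
| tr_bslash: "fDLG (X \<turnstile>\<^sub>0 PureD (BslashS (pemb P) (nemb N))) \<Longrightarrow> fDLG (X \<turnstile>\<^sub>0 PureD (NFm (Bslash P N)))"
| tr_slash: "fDLG (X \<turnstile>\<^sub>0 PureD (SlashS (nemb N) (pemb P))) \<Longrightarrow> fDLG (X \<turnstile>\<^sub>0 PureD (NFm (Slash N P)))"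
| tr_down: "fDLG (X \<turnstile>\<^sub>+ ShiftX (DownS (NFm N))) \<Longrightarrow> fDLG (X \<turnstile>\<^sub>+ ShiftX (SPFm (Down N)))"
| tr_up: "fDLG (ShiftD (UpS (PFm P)) \<turnstile>\<^sub>- D) \<Longrightarrow> fDLG (ShiftD (SNFm (Up P)) \<turnstile>\<^sub>- D)"
(* tonicity rules *)
| ton_otimes: "fDLG (X \<turnstile>\<^sub>+ pemb P) \<Longrightarrow> fDLG (Y \<turnstile>\<^sub>+ pemb Q) \<Longrightarrow>
    fDLG (PureX (OtimesS X Y) \<turnstile>\<^sub>+ PureX (PFm (Otimes P Q)))"
| ton_oplus: "fDLG (nemb N \<turnstile>\<^sub>- G) \<Longrightarrow> fDLG (nemb M \<turnstile>\<^sub>- D) \<Longrightarrow>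
    fDLG (PureD (NFm (Oplus N M)) \<turnstile>\<^sub>- PureD (OplusS G D))"
| ton_oslash: "fDLG (X \<turnstile>\<^sub>+ pemb P) \<Longrightarrow> fDLG (nemb N \<turnstile>\<^sub>- D) \<Longrightarrow>
    fDLG (PureX (OslashS X D) \<turnstile>\<^sub>+ PureX (PFm (Oslash P N)))"
| ton_ominus: "fDLG (X \<turnstile>\<^sub>+ pemb P) \<Longrightarrow> fDLG (nemb N \<turnstile>\<^sub>- D) \<Longrightarrow>
    fDLG (PureX (OminusS D X) \<turnstile>\<^sub>+ PureX (PFm (Ominus N P)))"
| ton_bslash: "fDLG (X \<turnstile>\<^sub>+ pemb P) \<Longrightarrow> fDLG (nemb N \<turnstile>\<^sub>- D) \<Longrightarrow>
    fDLG (PureD (NFm (Bslash P N)) \<turnstile>\<^sub>- PureD (BslashS X D))"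
| ton_slash: "fDLG (X \<turnstile>\<^sub>+ pemb P) \<Longrightarrow> fDLG (nemb N \<turnstile>\<^sub>- D) \<Longrightarrow>
    fDLG (PureD (NFm (Slash N P)) \<turnstile>\<^sub>- PureD (SlashS D X))"
| ton_down: "fDLG (PureD (NFm N) \<turnstile>\<^sub>- PureD D) \<Longrightarrow> fDLG (ShiftX (SPFm (Down N)) \<turnstile>\<^sub>+ ShiftX (DownS D))"
| ton_up: "fDLG (PureX X \<turnstile>\<^sub>+ PureX (PFm P)) \<Longrightarrow> fDLG (ShiftD (UpS X) \<turnstile>\<^sub>- ShiftD (SNFm (Up P)))"
(* display postulates: each chain of equivalences a, b, c gives ab, ba, bc, cb *)
| dp1ab: "fDLG (Y \<turnstile>\<^sub>0 PureD (BslashS X D)) \<Longrightarrow> fDLG (PureX (OtimesS X Y) \<turnstile>\<^sub>0 D)"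
| dp1ba: "fDLG (PureX (OtimesS X Y) \<turnstile>\<^sub>0 D) \<Longrightarrow> fDLG (Y \<turnstile>\<^sub>0 PureD (BslashS X D))"
| dp1bc: "fDLG (PureX (OtimesS X Y) \<turnstile>\<^sub>0 D) \<Longrightarrow> fDLG (X \<turnstile>\<^sub>0 PureD (SlashS D Y))"
| dp1cb: "fDLG (X \<turnstile>\<^sub>0 PureD (SlashS D Y)) \<Longrightarrow> fDLG (PureX (OtimesS X Y) \<turnstile>\<^sub>0 D)"
| dp2ab: "fDLG (PureX (OslashS X D) \<turnstile>\<^sub>0 G) \<Longrightarrow> fDLG (X \<turnstile>\<^sub>0 PureD (OplusS G D))"
| dp2ba: "fDLG (X \<turnstile>\<^sub>0 PureD (OplusS G D)) \<Longrightarrow> fDLG (PureX (OslashS X D) \<turnstile>\<^sub>0 G)"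
| dp2bc: "fDLG (X \<turnstile>\<^sub>0 PureD (OplusS G D)) \<Longrightarrow> fDLG (PureX (OminusS G X) \<turnstile>\<^sub>0 D)"
| dp2cb: "fDLG (PureX (OminusS G X) \<turnstile>\<^sub>0 D) \<Longrightarrow> fDLG (X \<turnstile>\<^sub>0 PureD (OplusS G D))"
| dp3ab: "fDLG (Y \<turnstile>\<^sub>+ ShiftX (BslashR X Z)) \<Longrightarrow> fDLG (PureX (OtimesS X Y) \<turnstile>\<^sub>+ Z)"
| dp3ba: "fDLG (PureX (OtimesS X Y) \<turnstile>\<^sub>+ Z) \<Longrightarrow> fDLG (Y \<turnstile>\<^sub>+ ShiftX (BslashR X Z))"
| dp3bc: "fDLG (PureX (OtimesS X Y) \<turnstile>\<^sub>+ Z) \<Longrightarrow> fDLG (X \<turnstile>\<^sub>+ ShiftX (SlashL Z Y))"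
| dp3cb: "fDLG (X \<turnstile>\<^sub>+ ShiftX (SlashL Z Y)) \<Longrightarrow> fDLG (PureX (OtimesS X Y) \<turnstile>\<^sub>+ Z)"
| dp4ab: "fDLG (ShiftD (OslashL S D) \<turnstile>\<^sub>- G) \<Longrightarrow> fDLG (S \<turnstile>\<^sub>- PureD (OplusS G D))"
| dp4ba: "fDLG (S \<turnstile>\<^sub>- PureD (OplusS G D)) \<Longrightarrow> fDLG (ShiftD (OslashL S D) \<turnstile>\<^sub>- G)"
| dp4bc: "fDLG (S \<turnstile>\<^sub>- PureD (OplusS G D)) \<Longrightarrow> fDLG (ShiftD (OminusR G S) \<turnstile>\<^sub>- D)"
| dp4cb: "fDLG (ShiftD (OminusR G S) \<turnstile>\<^sub>- D) \<Longrightarrow> fDLG (S \<turnstile>\<^sub>- PureD (OplusS G D))"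
| dp5ab: "fDLG (PureX (OminusS G X) \<turnstile>\<^sub>+ Y) \<Longrightarrow> fDLG (X \<turnstile>\<^sub>+ ShiftX (OplusR G Y))"
| dp5ba: "fDLG (X \<turnstile>\<^sub>+ ShiftX (OplusR G Y)) \<Longrightarrow> fDLG (PureX (OminusS G X) \<turnstile>\<^sub>+ Y)"
| dp5bc: "fDLG (X \<turnstile>\<^sub>+ ShiftX (OplusR G Y)) \<Longrightarrow> fDLG (ShiftD (OslashR X Y) \<turnstile>\<^sub>- G)"
| dp5cb: "fDLG (ShiftD (OslashR X Y) \<turnstile>\<^sub>- G) \<Longrightarrow> fDLG (X \<turnstile>\<^sub>+ ShiftX (OplusR G Y))"
| dp6ab: "fDLG (PureX (OslashS X D) \<turnstile>\<^sub>+ Y) \<Longrightarrow> fDLG (X \<turnstile>\<^sub>+ ShiftX (OplusL Y D))"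
| dp6ba: "fDLG (X \<turnstile>\<^sub>+ ShiftX (OplusL Y D)) \<Longrightarrow> fDLG (PureX (OslashS X D) \<turnstile>\<^sub>+ Y)"
| dp6bc: "fDLG (X \<turnstile>\<^sub>+ ShiftX (OplusL Y D)) \<Longrightarrow> fDLG (ShiftD (OminusL Y X) \<turnstile>\<^sub>- D)"
| dp6cb: "fDLG (ShiftD (OminusL Y X) \<turnstile>\<^sub>- D) \<Longrightarrow> fDLG (X \<turnstile>\<^sub>+ ShiftX (OplusL Y D))"
| dp7ab: "fDLG (G \<turnstile>\<^sub>- PureD (BslashS X D)) \<Longrightarrow> fDLG (ShiftD (OtimesR X G) \<turnstile>\<^sub>- D)"
| dp7ba: "fDLG (ShiftD (OtimesR X G) \<turnstile>\<^sub>- D) \<Longrightarrow> fDLG (G \<turnstile>\<^sub>- PureD (BslashS X D))"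
| dp7bc: "fDLG (ShiftD (OtimesR X G) \<turnstile>\<^sub>- D) \<Longrightarrow> fDLG (X \<turnstile>\<^sub>+ ShiftX (SlashR D G))"
| dp7cb: "fDLG (X \<turnstile>\<^sub>+ ShiftX (SlashR D G)) \<Longrightarrow> fDLG (ShiftD (OtimesR X G) \<turnstile>\<^sub>- D)"
| dp8ab: "fDLG (Y \<turnstile>\<^sub>+ ShiftX (BslashL G D)) \<Longrightarrow> fDLG (ShiftD (OtimesL G Y) \<turnstile>\<^sub>- D)"
| dp8ba: "fDLG (ShiftD (OtimesL G Y) \<turnstile>\<^sub>- D) \<Longrightarrow> fDLG (Y \<turnstile>\<^sub>+ ShiftX (BslashL G D))"
| dp8bc: "fDLG (ShiftD (OtimesL G Y) \<turnstile>\<^sub>- D) \<Longrightarrow> fDLG (G \<turnstile>\<^sub>- PureD (SlashS D Y))"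
| dp8cb: "fDLG (G \<turnstile>\<^sub>- PureD (SlashS D Y)) \<Longrightarrow> fDLG (ShiftD (OtimesL G Y) \<turnstile>\<^sub>- D)"
| dp9ab: "fDLG (ShiftD (UpS X) \<turnstile>\<^sub>- ShiftD D) \<Longrightarrow> fDLG (PureX X \<turnstile>\<^sub>+ PureX (DDownS D))"
| dp9ba: "fDLG (PureX X \<turnstile>\<^sub>+ PureX (DDownS D)) \<Longrightarrow> fDLG (ShiftD (UpS X) \<turnstile>\<^sub>- ShiftD D)"
| dp10ab: "fDLG (ShiftD (UpS X) \<turnstile>\<^sub>- PureD D) \<Longrightarrow> fDLG (PureX X \<turnstile>\<^sub>+ ShiftX (DownS D))"
| dp10ba: "fDLG (PureX X \<turnstile>\<^sub>+ ShiftX (DownS D)) \<Longrightarrow> fDLG (ShiftD (UpS X) \<turnstile>\<^sub>- PureD D)"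
| dp11ab: "fDLG (ShiftX X \<turnstile>\<^sub>+ ShiftX (DownS D)) \<Longrightarrow> fDLG (PureD (UUpS X) \<turnstile>\<^sub>- PureD D)"
| dp11ba: "fDLG (PureD (UUpS X) \<turnstile>\<^sub>- PureD D) \<Longrightarrow> fDLG (ShiftX X \<turnstile>\<^sub>+ ShiftX (DownS D))"
(* structural rules *)
| str_down_ab: "fDLG (X \<turnstile>\<^sub>0 PureD D) \<Longrightarrow> fDLG (X \<turnstile>\<^sub>+ ShiftX (DownS D))"
| str_down_ba: "fDLG (X \<turnstile>\<^sub>+ ShiftX (DownS D)) \<Longrightarrow> fDLG (X \<turnstile>\<^sub>0 PureD D)"
| str_up_ab: "fDLG (PureX X \<turnstile>\<^sub>0 D) \<Longrightarrow> fDLG (ShiftD (UpS X) \<turnstile>\<^sub>- D)"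
| str_up_ba: "fDLG (ShiftD (UpS X) \<turnstile>\<^sub>- D) \<Longrightarrow> fDLG (PureX X \<turnstile>\<^sub>0 D)"


section \<open>The translation\<close>

text \<open>
  \<open>posT A\<close> is \<open>A\<^sup>+\<close> and \<open>negT A\<close> is \<open>A\<^sup>-\<close>. The clauses for the opposite polarity are unfolded,
  since the shifts apply only to pure formulas; \<open>negT_positive\<close> and \<open>posT_negative\<close> give them in
  closed form.
\<close>

fun posT :: "ffm \<Rightarrow> gpfm" and negT :: "ffm \<Rightarrow> gnfm" where
  "posT (fPAt p) = PureP (PAt p)"
| "posT (fOtimes A B) = PureP (Otimes (posT A) (posT B))"
| "posT (fOslash A B) = PureP (Oslash (posT A) (negT B))"
| "posT (fOminus A B) = PureP (Ominus (negT A) (posT B))"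
| "posT (fNAt n) = ShiftP (Down (NAt n))"
| "posT (fOplus A B) = ShiftP (Down (Oplus (negT A) (negT B)))"
| "posT (fBslash A B) = ShiftP (Down (Bslash (posT A) (negT B)))"
| "posT (fSlash A B) = ShiftP (Down (Slash (negT A) (posT B)))"
| "negT (fNAt n) = PureN (NAt n)"
| "negT (fOplus A B) = PureN (Oplus (negT A) (negT B))"
| "negT (fBslash A B) = PureN (Bslash (posT A) (negT B))"
| "negT (fSlash A B) = PureN (Slash (negT A) (posT B))"
| "negT (fPAt p) = ShiftN (Up (PAt p))"
| "negT (fOtimes A B) = ShiftN (Up (Otimes (posT A) (posT B)))"
| "negT (fOslash A B) = ShiftN (Up (Oslash (posT A) (negT B)))"
| "negT (fOminus A B) = ShiftN (Up (Ominus (negT A) (posT B)))"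

lemma negT_positive: "positive A \<Longrightarrow> \<exists>P. posT A = PureP P \<and> negT A = ShiftN (Up P)"
  by (cases A) auto

lemma posT_negative: "negative A \<Longrightarrow> \<exists>N. negT A = PureN N \<and> posT A = ShiftP (Down N)"
  by (cases A) (auto simp: negative_def)

primrec inT :: "fin \<Rightarrow> gpst" and outT :: "fout \<Rightarrow> gnst" where
  "inT (fIn A) = pemb (posT A)"
| "inT (fOtimesS X Y) = PureX (OtimesS (inT X) (inT Y))"
| "inT (fOslashS X D) = PureX (OslashS (inT X) (outT D))"
| "inT (fOminusS D X) = PureX (OminusS (outT D) (inT X))"
| "outT (fOut A) = nemb (negT A)"
| "outT (fOplusS G D) = PureD (OplusS (outT G) (outT D))"
| "outT (fBslashS X D) = PureD (BslashS (inT X) (outT D))"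
| "outT (fSlashS D X) = PureD (SlashS (outT D) (inT X))"

fun seqT :: "fseq \<Rightarrow> dseq" where
  "seqT (RFocus X A) = (inT X \<turnstile>\<^sub>+ pemb (posT A))"
| "seqT (LFocus A D) = (nemb (negT A) \<turnstile>\<^sub>- outT D)"
| "seqT (Neutral X D) = (inT X \<turnstile>\<^sub>0 outT D)"

end

theory Submission
  imports Defs
begin

text \<open>
  Each rule of f.LG is simulated by at most two rules of fD.LG, without cuts. The delicate cases are
  the two focusing rules: the shift rules \<open>ton_up\<close> and \<open>ton_down\<close> require a pure structure opposite
  the focused formula. A positive formula in right focus can only come from an axiom or a tonicity
  rule, and both leave a structure with a pure translation on the left; dually for left focus.
\<close>

lemma RFocus_positive_pure:
  assumes "fLG (RFocus X A)" and "positive A"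
  obtains Y where "inT X = PureX Y"
  \<comment> \<open>Unfolding \<open>negative_def\<close> excludes \<open>f_defoc_neg\<close>, the
    only rule putting an arbitrary structure opposite a right focus.\<close>
  using assms by (cases rule: fLG.cases) (auto simp: negative_def)

lemma LFocus_negative_pure:
  assumes "fLG (LFocus A D)" and "negative A"
  obtains G where "outT D = PureD G"
  using assms by (cases rule: fLG.cases) (auto simp: negative_def)

theorem theorem45:
  fixes S :: fseq
  assumes "fLG S"
  shows "fDLG (seqT S)"
  using assms
proof (induction rule: fLG.induct)
  case (f_foc_pos A X)
  obtain P where P: "posT A = PureP P" "negT A = ShiftN (Up P)"
    using negT_positive f_foc_pos.hyps by blast
  obtain Y where "inT X = PureX Y"
    using RFocus_positive_pure f_foc_pos.hyps by blast
  \<comment> \<open>\<open>ton_up\<close> shifts both sides; \<open>str_up_ba\<close> then strips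
    the structural shift on the left.\<close>
  with f_foc_pos.IH P show ?case
    by (simp add: str_up_ba ton_up)
next
  case (f_defoc_pos A D)
  then show ?case
    \<comment> \<open>Here \<open>A\<close> itself translates to the pure structure that
      \<open>str_up_ab\<close> shifts.\<close>
    using negT_positive[of A] by (auto dest!: str_up_ab intro: tr_up)
next
  case (f_foc_neg A D)
  obtain N where N: "negT A = PureN N" "posT A = ShiftP (Down N)"
    using posT_negative f_foc_neg.hyps by blast
  obtain G where "outT D = PureD G"
    using LFocus_negative_pure f_foc_neg.hyps by blast
  with f_foc_neg.IH N show ?case
    by (simp add: str_down_ba ton_down)
next
  case (f_defoc_neg A X)
  then show ?case
    using posT_negative[of A] by (auto dest!: str_down_ab intro: tr_down)
\<comment> \<open>\<open>inT\<close> and \<open>outT\<close> preserve structural connectives, so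
  each remaining rule becomes its namesake.\<close>
qed (simp_all,
    (rule axP axN
    | erule dp1ab dp1ba dp1bc dp1cb dp2ab dp2ba dp2bc dp2cb
        tr_otimes tr_oslash tr_ominus tr_oplus tr_bslash tr_slash
    | erule (1) ton_otimes ton_oplus ton_oslash ton_ominus ton_bslash ton_slash)+)

end
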